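(* Let $(A,\Phi)$ be any $\mathcal{C}^{\infty}$-ring. The $\mathcal{C}^{\infty}$-congruences of $(A,\Phi)$ are classified by the ring-theoretic ideals of $(A,\Phi)$; that is, the map $$\psi_{A}: \mathrm{Cong}(A,\Phi) \to \mathfrak{I}(A,\Phi),\quad R \mapsto \{ a \in A \mid (a,\Phi(0)) \in R\}$$ from the set of $\mathcal{C}^{\infty}$-congruences of $(A,\Phi)$ to the set of ideals of $(A,\Phi)$ is a bijection.
   Context: $\mathbb{N}=\{0,1,2,\dots\}$. A $\mathcal{C}^{\infty}$-structure is a pair $(A,\Phi)$, where $A$ is a set and $\Phi$ assigns to each $n\in\mathbb{N}$ and each smooth function $f\in\mathcal{C}^{\infty}(\mathbb{R}^n,\mathbb{R})$ a function $\Phi(f):A^n\to A$. It is a $\mathcal{C}^{\infty}$-ring if (1) for each $n$ and $k\le n$, the projection $p_k:\mathbb{R}^n\to\mathbb{R}$ onto the $k$-th coordinate is sent to the projection $\pi_k:A^n\to A$ onto the $k$-th coordinate; and (2) whenever $f\in\mathcal{C}^{\infty}(\mathbb{R}^n,\mathbb{R})$, $g_1,\dots,g_n,h\in\mathcal{C}^{\infty}(\mathbb{R}^k,\mathbb{R})$ and $h=f\circ(g_1,\dots,g_n)$, then $\Phi(h)=\Phi(f)\circ(\Phi(g_1),\dots,\Phi(g_n))$. Any $\mathcal{C}^{\infty}$-ring $(A,\Phi)$ is regarded as a commutative unital ring with operations $\Phi(+),\Phi(\cdot),\Phi(-)$ and constants $0=\Phi(0)$, $1=\Phi(1)$; a (ring-theoretic)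 ideal of $(A,\Phi)$ means an ideal of this commutative ring. A $\mathcal{C}^{\infty}$-congruence on $(A,\Phi)$ is an equivalence relation $R\subseteq A\times A$ such that for all $n$, $f\in\mathcal{C}^{\infty}(\mathbb{R}^n,\mathbb{R})$ and $(x_1,y_1),\dots,(x_n,y_n)\in R$ one has $(\Phi(f)(x_1,\dots,x_n),\Phi(f)(y_1,\dots,y_n))\in R$. *)

theory Defs
  imports "HOL-Analysis.Analysis" "HOL-Algebra.Ideal"
begin

text \<open>
  An $n$-tuple over a set \<open>A\<close> is an extensional function in \<open>{..<n} \<rightarrow>\<^sub>E A\<close>; coordinates are
  numbered from \<open>0\<close>. This makes $A^n$ available for a variable \<open>n\<close>. For \<open>A = UNIV :: real set\<close>
  the product topology on \<open>nat \<Rightarrow> real\<close> induces the Euclidean topology on these tuples.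
\<close>

abbreviation tuples :: "nat \<Rightarrow> 'a set \<Rightarrow> (nat \<Rightarrow> 'a) set"
  where "tuples n A \<equiv> {..<n} \<rightarrow>\<^sub>E A"

abbreviation Rn :: "nat \<Rightarrow> (nat \<Rightarrow> real) set"
  where "Rn n \<equiv> tuples n UNIV"

definition tuple :: "'a list \<Rightarrow> nat \<Rightarrow> 'a"
  where "tuple xs = (\<lambda>i\<in>{..<length xs}. xs ! i)"

definition partial_deriv :: "nat \<Rightarrow> ((nat \<Rightarrow> real) \<Rightarrow> real) \<Rightarrow> (nat \<Rightarrow> real) \<Rightarrow> real"
  where "partial_deriv i f = (\<lambda>x. deriv (\<lambda>t. f (x(i := t))) (x i))"

text \<open>
  Smoothness: the iterated partial derivatives of all orders exist and are continuous on all of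
  $R^n$. The list \<open>is\<close> records the directions of differentiation, the last entry being applied
  first. Elements of \<open>smooth_funs n\<close> are extensional, so that they are determined by their
  values on $R^n$.
\<close>

definition smooth_funs :: "nat \<Rightarrow> ((nat \<Rightarrow> real) \<Rightarrow> real) set"
  where "smooth_funs n =
    {f \<in> extensional (Rn n).
      \<forall>is. set is \<subseteq> {..<n} \<longrightarrow>
        continuous_on (Rn n) (foldr partial_deriv is f) \<and>
        (\<forall>i<n. \<forall>x\<in>Rn n. (\<lambda>t. foldr partial_deriv is f (x(i := t))) differentiable (at (x i)))}"

text \<open>
  A structure map is given as \<open>\<Phi> n f\<close>, with the arity \<open>n\<close> explicit; only its values at
  \<open>f \<in> smooth_funs n\<close> and at tuples in \<open>tuples n A\<close> are relevant.
\<close>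

type_synonym 'a cinf_map = "nat \<Rightarrow> ((nat \<Rightarrow> real) \<Rightarrow> real) \<Rightarrow> (nat \<Rightarrow> 'a) \<Rightarrow> 'a"

definition cinf_structure :: "'a set \<Rightarrow> 'a cinf_map \<Rightarrow> bool"
  where "cinf_structure A \<Phi> \<longleftrightarrow> (\<forall>n. \<forall>f\<in>smooth_funs n. \<Phi> n f \<in> tuples n A \<rightarrow> A)"

definition cinf_ring :: "'a set \<Rightarrow> 'a cinf_map \<Rightarrow> bool"
  where "cinf_ring A \<Phi> \<longleftrightarrow>
    cinf_structure A \<Phi> \<and>
    (\<forall>n. \<forall>k<n. \<forall>a\<in>tuples n A. \<Phi> n (\<lambda>x\<in>Rn n. x k) a = a k) \<and>
    (\<forall>n k f g h.
      f \<in> smooth_funs n \<longrightarrow> (\<forall>i<n. g i \<in> smooth_funs k) \<longrightarrow> h \<in> smooth_funs k \<longrightarrow>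
      (\<forall>x\<in>Rn k. h x = f (\<lambda>i\<in>{..<n}. g i x)) \<longrightarrow>
      (\<forall>a\<in>tuples k A. \<Phi> k h a = \<Phi> n f (\<lambda>i\<in>{..<n}. \<Phi> k (g i) a)))"

text \<open>
  The underlying commutative ring. Real constants are regarded as functions on $R^0$. The record
  type has no field for negation: the operation induced by $x \mapsto -x$ is the additive
  inverse, which is determined by addition and zero.
\<close>

definition ring_of_cinf :: "'a set \<Rightarrow> 'a cinf_map \<Rightarrow> 'a ring"
  where "ring_of_cinf A \<Phi> =
    \<lparr>carrier = A,
     monoid.mult = (\<lambda>a b. \<Phi> 2 (\<lambda>x\<in>Rn 2. x 0 * x 1) (tuple [a, b])),
     one = \<Phi> 0 (\<lambda>x\<in>Rn 0. 1) (tuple []),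
     zero = \<Phi> 0 (\<lambda>x\<in>Rn 0. 0) (tuple []),
     add = (\<lambda>a b. \<Phi> 2 (\<lambda>x\<in>Rn 2. x 0 + x 1) (tuple [a, b]))\<rparr>"

definition cinf_ideals :: "'a set \<Rightarrow> 'a cinf_map \<Rightarrow> 'a set set"
  where "cinf_ideals A \<Phi> = {I. ideal I (ring_of_cinf A \<Phi>)}"

definition cinf_congruences :: "'a set \<Rightarrow> 'a cinf_map \<Rightarrow> ('a \<times> 'a) set set"
  where "cinf_congruences A \<Phi> =
    {R. equiv A R \<and>
      (\<forall>n. \<forall>f\<in>smooth_funs n. \<forall>x\<in>tuples n A. \<forall>y\<in>tuples n A.
        (\<forall>i<n. (x i, y i) \<in> R) \<longrightarrow> (\<Phi> n f x, \<Phi> n f y) \<in> R)}"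

end

(*
  A congruence R contains (a, b) iff it contains (a - b, 0), so R is determined by its zero class.
  Conversely, for an ideal I the relation a - b \<in> I is a C-infinity congruence: replacing the
  arguments of \<Phi>(f) one at a time, transitivity reduces the claim to a change of a single coordinate
  i, and there Hadamard's lemma
    f(x) - f(x(i := s)) = (x_i - s) * g(x, s),
    g(x, s) = \<integral>_0^1 (\<partial>_i f)(x(i := s + t (x_i - s))) dt,
  with g smooth, transfers to A and shows that the difference of the values is a multiple of the
  difference of the changed arguments.
*)
theory Submission
  imports Defs
begin

text \<open>The weight lies in the smoothness of \<open>g\<close>. Dividing
  \<open>f(x) - f(x(i := s))\<close> by \<open>x_i - s\<close> says nothing about smoothness where
  \<open>x_i = s\<close>; the integral makes sense there too and can be differentiated under the
  integral sign. Since smoothness means continuous iterated partial derivatives, the chain rule and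
  the closure of smooth functions under composition are derived from partial derivatives alone. The
  number \<open>s\<close> has to be an argument of \<open>g\<close>, not a parameter: the new value
  of the changed coordinate is an arbitrary element of \<open>A\<close>, so what transfers is one
  identity between functions of \<open>n + 1\<close> real variables, evaluated at a tuple of
  \<open>n + 1\<close> elements of \<open>A\<close>. The integral itself is never interpreted in
  \<open>A\<close>; only the smooth function that it defines is.\<close>

section \<open>Coordinatewise limits and the chain rule along a curve\<close>

lemma tendsto_fun:
  fixes l :: "'b \<Rightarrow> 'c::topological_space"
  assumes "\<And>j. ((\<lambda>t. f t j) \<longlongrightarrow> l j) F"
  shows "(f \<longlongrightarrow> l) F"
proof -
  have "limitin (product_topology (\<lambda>_. euclidean) UNIV) f l F"
    using assms by (simp add: limitin_componentwise)
  then show ?thesis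
    by (simp add: euclidean_product_topology)
qed

lemma tuples_fun_upd [simp, intro]: "x \<in> tuples n A \<Longrightarrow> i < n \<Longrightarrow> t \<in> A \<Longrightarrow> x(i := t) \<in> tuples n A"
  by (auto simp: PiE_iff extensional_def)

lemma tuples_fun_upd_Suc [simp, intro]: "x \<in> tuples n A \<Longrightarrow> t \<in> A \<Longrightarrow> x(n := t) \<in> tuples (Suc n) A"
  by (auto simp: PiE_iff extensional_def less_Suc_eq)

lemma restrict_tuples [simp, intro]: "(\<And>i. i < n \<Longrightarrow> f i \<in> A) \<Longrightarrow> (\<lambda>i\<in>{..<n}. f i) \<in> tuples n A"
  by auto

text \<open>The increment of \<open>f\<close> along the curve telescopes into increments in a single
  coordinate. The mean value theorem turns each of these into a value of \<open>f' k\<close> at an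
  intermediate point times the increment of \<open>c t k\<close>, and continuity of
  \<open>f' k\<close> gives the limit of the first factor. Total differentiability of
  \<open>f\<close> never enters.\<close>

lemma chain_rule_Rn:
  fixes c :: "real \<Rightarrow> nat \<Rightarrow> real"
  assumes cont: "\<And>i. i < m \<Longrightarrow> continuous_on (Rn m) (f' i)"
    and der: "\<And>i x. i < m \<Longrightarrow> x \<in> Rn m \<Longrightarrow>
      ((\<lambda>t. f (x(i := t))) has_field_derivative f' i x) (at (x i))"
    and c: "\<And>t. c t \<in> Rn m"
    and c': "\<And>i. i < m \<Longrightarrow> ((\<lambda>t. c t i) has_field_derivative c' i) (at s)"
  shows "((\<lambda>t. f (c t)) has_field_derivative (\<Sum>i<m. f' i (c s) * c' i)) (at s)"
proof -
  \<comment> \<open>Move from \<open>c s\<close> to \<open>c t\<close> one coordinate at a time.\<close>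
  define P where "P k t = (\<lambda>j. if j < k then c t j else c s j)" for k t
  have P_in: "P k t \<in> Rn m" for k t
    using c[of t] c[of s] by (auto simp: P_def PiE_iff extensional_def)
  have P_0: "P 0 t = c s" for t
    by (simp add: P_def)
  have P_m: "P m t = c t" for t
    using c[of t] c[of s] by (auto simp: P_def PiE_iff extensional_def fun_eq_iff)
  have P_s: "P k s = c s" for k
    by (simp add: P_def)
  have P_Suc: "P (Suc k) t = (P k t)(k := c t k)" for k t
    by (auto simp: P_def fun_eq_iff less_Suc_eq)
  have cont_c: "((\<lambda>t. c t j) \<longlongrightarrow> c s j) (at s)" for j
  proof (cases "j < m")
    case True
    then show ?thesis using c' DERIV_isCont isCont_def by blast
  next
    case False
    then have "c t j = c s j" for t
      using c[of t] c[of s] by (auto simp: PiE_iff extensional_def)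
    then have "(\<lambda>t. c t j) = (\<lambda>_. c s j)" by blast
    then show ?thesis by (metis tendsto_const)
  qed
  have step: "((\<lambda>t. f (P (Suc k) t) - f (P k t)) has_field_derivative f' k (c s) * c' k) (at s)"
    if k: "k < m" for k
  proof -
    \<comment> \<open>The choice of \<open>\<xi>\<close> need not be continuous in \<open>t\<close>:
      the bound alone squeezes it to \<open>c s k\<close>. If the coordinate does not move, both
      sides vanish and \<open>c s k\<close> serves as \<open>\<xi>\<close>.\<close>
    have "\<exists>\<xi>. \<bar>\<xi> - c s k\<bar> \<le> \<bar>c t k - c s k\<bar> \<and>
        f (P (Suc k) t) - f (P k t) = (c t k - c s k) * f' k ((P k t)(k := \<xi>))" for t
    proof -
      let ?h = "\<lambda>u. f ((P k t)(k := u))"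
      have d: "(?h has_field_derivative f' k ((P k t)(k := u))) (at u)" for u
        using der[OF k, of "(P k t)(k := u)"] P_in[of k t] k by simp
      have Pk: "P k t = (P k t)(k := c s k)"
        by (auto simp: P_def fun_eq_iff)
      have e: "f (P (Suc k) t) - f (P k t) = ?h (c t k) - ?h (c s k)"
        using Pk by (metis P_Suc)
      consider "c t k = c s k" | "c t k < c s k" | "c s k < c t k" by linarith
      then show ?thesis
      proof cases
        case 1
        then show ?thesis using e by (intro exI[of _ "c s k"]) auto
      next
        case 2
        from MVT2[OF 2, of ?h "\<lambda>u. f' k ((P k t)(k := u))"] d
        obtain z where z: "c t k < z" "z < c s k"
          "?h (c s k) - ?h (c t k) = (c s k - c t k) * f' k ((P k t)(k := z))" by blast
        then show ?thesis using e by (intro exI[of _ z]) (auto simp: algebra_simps)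
      next
        case 3
        from MVT2[OF 3, of ?h "\<lambda>u. f' k ((P k t)(k := u))"] d
        obtain z where z: "c s k < z" "z < c t k"
          "?h (c t k) - ?h (c s k) = (c t k - c s k) * f' k ((P k t)(k := z))" by blast
        then show ?thesis using e by (intro exI[of _ z]) (auto simp: algebra_simps)
      qed
    qed
    then obtain \<xi> where \<xi>: "\<And>t. \<bar>\<xi> t - c s k\<bar> \<le> \<bar>c t k - c s k\<bar>"
      and diff: "\<And>t. f (P (Suc k) t) - f (P k t) = (c t k - c s k) * f' k ((P k t)(k := \<xi> t))"
      by metis
    have \<xi>_lim: "(\<xi> \<longlongrightarrow> c s k) (at s)"
    proof -
      have "((\<lambda>t. \<bar>c t k - c s k\<bar>) \<longlongrightarrow> 0) (at s)"
        using cont_c[of k] tendsto_rabs_zero LIM_zero by blast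
      then have "((\<lambda>t. \<xi> t - c s k) \<longlongrightarrow> 0) (at s)"
        by (rule Lim_null_comparison[rotated]) (simp add: \<xi>)
      then show ?thesis by (simp add: LIM_zero_iff)
    qed
    \<comment> \<open>Coordinates below \<open>k\<close> follow the curve, coordinate
      \<open>k\<close> is \<open>\<xi> t\<close>, and those above are frozen at \<open>c s\<close>;
      each tends to its value at \<open>s\<close>.\<close>
    have lim: "((\<lambda>t. (P k t)(k := \<xi> t)) \<longlongrightarrow> c s) (at s)"
    proof (rule tendsto_fun)
      show "((\<lambda>t. ((P k t)(k := \<xi> t)) j) \<longlongrightarrow> c s j) (at s)" for j
        using \<xi>_lim cont_c[of j] by (cases "j = k"; cases "j < k") (auto simp: P_def)
    qed
    have "((\<lambda>t. f' k ((P k t)(k := \<xi> t))) \<longlongrightarrow> f' k (c s)) (at s)"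
      using P_in k by (intro continuous_on_tendsto_compose[OF cont[OF k] lim c]) auto
    moreover have "((\<lambda>t. (c t k - c s k) / (t - s)) \<longlongrightarrow> c' k) (at s)"
      using c'[OF k] by (simp add: has_field_derivative_iff)
    ultimately have "((\<lambda>t. f' k ((P k t)(k := \<xi> t)) * ((c t k - c s k) / (t - s)))
        \<longlongrightarrow> f' k (c s) * c' k) (at s)"
      by (rule tendsto_mult)
    then show ?thesis
      by (simp add: has_field_derivative_iff diff P_s mult.commute)
  qed
  have "((\<lambda>t. \<Sum>k<m. f (P (Suc k) t) - f (P k t)) has_field_derivative
      (\<Sum>k<m. f' k (c s) * c' k)) (at s)"
    by (rule DERIV_sum) (use step in auto)
  then have "((\<lambda>t. f (c t) - f (c s)) has_field_derivative (\<Sum>k<m. f' k (c s) * c' k)) (at s)"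
    by (simp add: sum_lessThan_telescope[of "\<lambda>k. f (P k _)"] P_0 P_m)
  then have "((\<lambda>t. f (c t) - f (c s) + f (c s)) has_field_derivative
      (\<Sum>k<m. f' k (c s) * c' k) + 0) (at s)"
    by (rule DERIV_add) simp
  then show ?thesis by simp
qed

section \<open>Smoothness by coinduction\<close>

text \<open>Differentiation never leads out of \<open>S\<close>: by induction on the list of
  directions, every iterated derivative agrees on \<open>Rn n\<close> with a member of
  \<open>S\<close>. Only values on \<open>Rn n\<close> are compared, so members of \<open>S\<close>
  may be written as unrestricted formulas.\<close>

lemma smooth_funs_coinduct:
  assumes "f \<in> S"
    and cont: "\<And>f. f \<in> S \<Longrightarrow> continuous_on (Rn n) f"
    and deriv: "\<And>f i. f \<in> S \<Longrightarrow> i < n \<Longrightarrow> \<exists>g\<in>S. \<forall>x\<in>Rn n.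
      ((\<lambda>t. f (x(i := t))) has_field_derivative g x) (at (x i))"
  shows "restrict f (Rn n) \<in> smooth_funs n"
proof -
  let ?f = "restrict f (Rn n)"
  have inS: "\<exists>g\<in>S. \<forall>x\<in>Rn n. foldr partial_deriv is ?f x = g x" if "set is \<subseteq> {..<n}" for "is"
    using that
  proof (induction "is")
    case Nil
    show ?case using \<open>f \<in> S\<close> by auto
  next
    case (Cons i "is")
    then obtain g where g: "g \<in> S" "\<And>x. x \<in> Rn n \<Longrightarrow> foldr partial_deriv is ?f x = g x"
      using Cons.IH by (metis insert_subset list.simps(15))
    obtain h where h: "h \<in> S" "\<And>x. x \<in> Rn n \<Longrightarrow>
        ((\<lambda>t. g (x(i := t))) has_field_derivative h x) (at (x i))"
      using deriv[OF g(1), of i] Cons.prems by auto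
    have "foldr partial_deriv (i # is) ?f x = h x" if "x \<in> Rn n" for x
    proof -
      \<comment> \<open>Moving coordinate \<open>i\<close> of a point of \<open>Rn n\<close> stays
        inside \<open>Rn n\<close>, so agreement there passes to the partial derivatives.\<close>
      have "(\<lambda>t. foldr partial_deriv is ?f (x(i := t))) = (\<lambda>t. g (x(i := t)))"
        using that Cons.prems by (intro ext g(2)) auto
      then show ?thesis using h(2)[OF that]
        by (simp add: partial_deriv_def DERIV_imp_deriv)
    qed
    then show ?case using h(1) by blast
  qed
  have "continuous_on (Rn n) (foldr partial_deriv is ?f)"
    and "\<forall>i<n. \<forall>x\<in>Rn n. (\<lambda>t. foldr partial_deriv is ?f (x(i := t))) differentiable (at (x i))"
    if ds: "set is \<subseteq> {..<n}" for "is"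
  proof -
    obtain g where g: "g \<in> S" "\<And>x. x \<in> Rn n \<Longrightarrow> foldr partial_deriv is ?f x = g x"
      using inS[OF ds] by blast
    show "continuous_on (Rn n) (foldr partial_deriv is ?f)"
      using cont[OF g(1)] g(2) continuous_on_cong by blast
    show "\<forall>i<n. \<forall>x\<in>Rn n. (\<lambda>t. foldr partial_deriv is ?f (x(i := t))) differentiable (at (x i))"
    proof (intro allI ballI impI)
      fix i x assume i: "i < n" and x: "x \<in> Rn n"
      have "(\<lambda>t. foldr partial_deriv is ?f (x(i := t))) = (\<lambda>t. g (x(i := t)))"
        using i x by (intro ext g(2)) auto
      then show "(\<lambda>t. foldr partial_deriv is ?f (x(i := t))) differentiable (at (x i))"
        using deriv[OF g(1) i] x by (auto simp: real_differentiable_def)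
    qed
  qed
  then show ?thesis
    by (auto simp: smooth_funs_def)
qed

lemma smooth_funsD:
  assumes "f \<in> smooth_funs n" "set is \<subseteq> {..<n}"
  shows "continuous_on (Rn n) (foldr partial_deriv is f)"
    and "i < n \<Longrightarrow> x \<in> Rn n \<Longrightarrow>
      (\<lambda>t. foldr partial_deriv is f (x(i := t))) differentiable (at (x i))"
  using assms by (simp_all add: smooth_funs_def)

lemma smooth_funs_continuous: "f \<in> smooth_funs n \<Longrightarrow> continuous_on (Rn n) f"
  by (drule smooth_funsD[of _ _ "[]"]) auto

lemma restrict_smooth_funs [simp]: "f \<in> smooth_funs n \<Longrightarrow> restrict f (Rn n) = f"
  by (simp add: smooth_funs_def extensional_restrict)

lemma smooth_funs_has_partial_deriv:
  assumes "f \<in> smooth_funs n" "i < n" "x \<in> Rn n"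
  shows "((\<lambda>t. f (x(i := t))) has_field_derivative partial_deriv i f x) (at (x i))"
proof -
  have "(\<lambda>t. f (x(i := t))) differentiable (at (x i))"
    using smooth_funsD(2)[OF assms(1), of "[]"] assms by simp
  then show ?thesis
    by (simp add: partial_deriv_def DERIV_deriv_iff_real_differentiable)
qed

text \<open>The set of all iterated derivatives of \<open>f\<close> is closed under differentiation
  and serves as the coinduction set. The restriction restores extensionality, which
  \<open>partial_deriv\<close> need not preserve.\<close>

lemma partial_deriv_smooth_funs:
  assumes f: "f \<in> smooth_funs n" and i: "i < n"
  shows "restrict (partial_deriv i f) (Rn n) \<in> smooth_funs n"
proof (rule smooth_funs_coinduct)
  let ?S = "{foldr partial_deriv is f | is. set is \<subseteq> {..<n}}"
  show "partial_deriv i f \<in> ?S"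
    using i by (auto intro!: exI[of _ "[i]"])
  show "continuous_on (Rn n) g" if "g \<in> ?S" for g
    using that f by (auto simp: smooth_funs_def)
  show "\<exists>h\<in>?S. \<forall>x\<in>Rn n. ((\<lambda>t. g (x(j := t))) has_field_derivative h x) (at (x j))"
    if g: "g \<in> ?S" and j: "j < n" for g j
  proof (intro bexI ballI)
    show "partial_deriv j g \<in> ?S"
    proof -
      obtain "is" where "set is \<subseteq> {..<n}" "g = foldr partial_deriv is f" using g by auto
      then show ?thesis using j by (auto intro!: exI[of _ "j # is"])
    qed
    show "((\<lambda>t. g (x(j := t))) has_field_derivative partial_deriv j g x) (at (x j))"
      if "x \<in> Rn n" for x
    proof -
      have "(\<lambda>t. g (x(j := t))) differentiable (at (x j))"
        using g f j that by (auto simp: smooth_funs_def)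
      then show ?thesis
        by (simp add: partial_deriv_def DERIV_deriv_iff_real_differentiable)
    qed
  qed
qed

section \<open>Constants, coordinates, sums, products and compositions\<close>

lemma smooth_funs_const: "(\<lambda>x\<in>Rn n. c) \<in> smooth_funs n"
  by (rule smooth_funs_coinduct[where S = "range (\<lambda>c x. c)"])
    (auto intro!: derivative_eq_intros exI[of _ 0])

lemma smooth_funs_proj:
  assumes "k < n"
  shows "(\<lambda>x\<in>Rn n. x k) \<in> smooth_funs n"
proof (rule smooth_funs_coinduct)
  let ?S = "insert (\<lambda>x. x k) (range (\<lambda>c x. c)) :: ((nat \<Rightarrow> real) \<Rightarrow> real) set"
  show "(\<lambda>x. x k) \<in> ?S" by simp
  show "continuous_on (Rn n) f" if "f \<in> ?S" for f
    using that continuous_on_subset[OF continuous_on_product_coordinates] by auto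
  show "\<exists>g\<in>?S. \<forall>x\<in>Rn n. ((\<lambda>t. f (x(i := t))) has_field_derivative g x) (at (x i))"
    if "f \<in> ?S" "i < n" for f i
    using that(1)
  proof (rule insertE)
    assume f: "f = (\<lambda>x. x k)"
    show ?thesis
      by (rule bexI[of _ "\<lambda>_. if i = k then 1 else 0"]) (auto simp: f)
  next
    assume "f \<in> range (\<lambda>c x. c)"
    then obtain c where f: "f = (\<lambda>_. c)" by auto
    show ?thesis
      by (rule bexI[of _ "\<lambda>_. 0"]) (auto simp: f)
  qed
qed

text \<open>
  The chain rule writes a partial derivative of a composition as a sum of products of compositions
  of smooth functions. The closure below therefore contains the partial derivatives of its members,
  and coinduction gives smoothness of sums, products and compositions at once.
\<close>

inductive smooth_closure :: "nat \<Rightarrow> ((nat \<Rightarrow> real) \<Rightarrow> real) \<Rightarrow> bool" for n where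
  smooth: "f \<in> smooth_funs n \<Longrightarrow> smooth_closure n f"
| add: "smooth_closure n f \<Longrightarrow> smooth_closure n g \<Longrightarrow> smooth_closure n (\<lambda>x. f x + g x)"
| mult: "smooth_closure n f \<Longrightarrow> smooth_closure n g \<Longrightarrow> smooth_closure n (\<lambda>x. f x * g x)"
| comp: "f \<in> smooth_funs m \<Longrightarrow> (\<And>i. i < m \<Longrightarrow> g i \<in> smooth_funs n) \<Longrightarrow>
    smooth_closure n (\<lambda>x. f (\<lambda>i\<in>{..<m}. g i x))"

lemma smooth_closure_const: "\<exists>f. smooth_closure n f \<and> (\<forall>x\<in>Rn n. f x = c)"
  using smooth_closure.smooth[OF smooth_funs_const[of c n]]
  by (intro exI[of _ "\<lambda>x\<in>Rn n. c"]) simp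

text \<open>The empty sum enters the closure as a restricted constant, whose values outside
  \<open>Rn n\<close> are \<open>undefined\<close>; hence a function that equals the sum only on
  \<open>Rn n\<close>.\<close>

lemma smooth_closure_sum:
  fixes m :: nat
  assumes "\<And>i. i < m \<Longrightarrow> smooth_closure n (f i)"
  shows "\<exists>g. smooth_closure n g \<and> (\<forall>x\<in>Rn n. g x = (\<Sum>i<m. f i x))"
  using assms
proof (induction m)
  case 0
  then show ?case using smooth_closure_const[of n 0] by simp
next
  case (Suc m)
  then obtain g where "smooth_closure n g" "\<forall>x\<in>Rn n. g x = (\<Sum>i<m. f i x)"
    by (metis less_SucI)
  then show ?case using smooth_closure.add[of n g "f m"] Suc.prems[of m]
    by (intro exI[of _ "\<lambda>x. g x + f m x"]) simp
qed

lemma smooth_closure_continuous: "smooth_closure n f \<Longrightarrow> continuous_on (Rn n) f"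
proof (induction rule: smooth_closure.induct)
  case (comp f m g)
  have "continuous_on (Rn n) (\<lambda>x. \<lambda>i\<in>{..<m}. g i x)"
  proof (rule continuous_on_coordinatewise_then_product)
    show "continuous_on (Rn n) (\<lambda>x. (\<lambda>i\<in>{..<m}. g i x) j)" for j
      using comp(2)[of j] by (cases "j < m") (auto intro: smooth_funs_continuous)
  qed
  then show ?case
    by (rule continuous_on_compose2[OF smooth_funs_continuous[OF comp(1)]]) auto
qed (auto intro: continuous_intros smooth_funs_continuous)

lemma smooth_closure_deriv:
  assumes "smooth_closure n f" "i < n"
  shows "\<exists>g. smooth_closure n g \<and>
    (\<forall>x\<in>Rn n. ((\<lambda>t. f (x(i := t))) has_field_derivative g x) (at (x i)))"
  using assms(1)
proof (induction rule: smooth_closure.induct)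
  case (smooth f)
  show ?case
  proof (intro exI conjI ballI)
    show "smooth_closure n (restrict (partial_deriv i f) (Rn n))"
      using smooth assms(2) by (intro smooth_closure.smooth partial_deriv_smooth_funs)
    show "((\<lambda>t. f (x(i := t))) has_field_derivative restrict (partial_deriv i f) (Rn n) x)
        (at (x i))" if "x \<in> Rn n" for x
      using smooth_funs_has_partial_deriv[OF smooth assms(2) that] that by simp
  qed
next
  case (add f g)
  then obtain f' g' where "smooth_closure n f'" "smooth_closure n g'"
    "\<forall>x\<in>Rn n. ((\<lambda>t. f (x(i := t))) has_field_derivative f' x) (at (x i))"
    "\<forall>x\<in>Rn n. ((\<lambda>t. g (x(i := t))) has_field_derivative g' x) (at (x i))" by blast
  then show ?case
    by (intro exI[of _ "\<lambda>x. f' x + g' x"]) (intro conjI ballI smooth_closure.add DERIV_add; blast)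
next
  case (mult f g)
  then obtain f' g' where fg: "smooth_closure n f'" "smooth_closure n g'"
    "\<forall>x\<in>Rn n. ((\<lambda>t. f (x(i := t))) has_field_derivative f' x) (at (x i))"
    "\<forall>x\<in>Rn n. ((\<lambda>t. g (x(i := t))) has_field_derivative g' x) (at (x i))" by blast
  show ?case
  proof (intro exI[of _ "\<lambda>x. f' x * g x + g' x * f x"] conjI ballI)
    show "smooth_closure n (\<lambda>x. f' x * g x + g' x * f x)"
      using fg mult by (intro smooth_closure.add smooth_closure.mult) auto
    show "((\<lambda>t. f (x(i := t)) * g (x(i := t))) has_field_derivative f' x * g x + g' x * f x)
        (at (x i))" if "x \<in> Rn n" for x
      using DERIV_mult[of "\<lambda>t. f (x(i := t))" "f' x" "x i" UNIV "\<lambda>t. g (x(i := t))" "g' x"] fg that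
      by simp
  qed
next
  case (comp f m g)
  let ?c = "\<lambda>x. \<lambda>j\<in>{..<m}. g j x"
  let ?f' = "\<lambda>j. restrict (partial_deriv j f) (Rn m)"
  let ?g' = "\<lambda>j. restrict (partial_deriv i (g j)) (Rn n)"
  have "smooth_closure n (\<lambda>x. ?f' j (?c x) * ?g' j x)" if "j < m" for j
    using that comp(1,2) assms(2)
    by (intro smooth_closure.mult smooth_closure.comp smooth_closure.smooth
        partial_deriv_smooth_funs)
  then obtain h where h: "smooth_closure n h"
    "\<forall>x\<in>Rn n. h x = (\<Sum>j<m. ?f' j (?c x) * ?g' j x)"
    using smooth_closure_sum[of m n "\<lambda>j x. ?f' j (?c x) * ?g' j x"] by blast
  show ?case
  proof (intro exI[of _ h] conjI ballI h(1))
    fix x assume x: "x \<in> Rn n"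
    \<comment> \<open>The curve is the image under the inner functions of the line through
      \<open>x\<close> in direction \<open>i\<close>. Its base point is written
      \<open>x(i := x i)\<close> to match the value of the curve at \<open>x i\<close>.\<close>
    have "((\<lambda>t. f (?c (x(i := t)))) has_field_derivative
        (\<Sum>j<m. ?f' j (?c (x(i := x i))) * ?g' j x)) (at (x i))"
    proof (rule chain_rule_Rn)
      show "continuous_on (Rn m) (?f' j)" if "j < m" for j
        using comp(1) that by (intro smooth_funs_continuous partial_deriv_smooth_funs)
      show "((\<lambda>t. f (y(j := t))) has_field_derivative ?f' j y) (at (y j))"
        if "j < m" "y \<in> Rn m" for j y
        using smooth_funs_has_partial_deriv[OF comp(1) that] that by simp
      show "((\<lambda>t. ?c (x(i := t)) j) has_field_derivative ?g' j x) (at (x i))" if "j < m" for j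
        using smooth_funs_has_partial_deriv[OF comp(2)[OF that] assms(2) x] that x by simp
    qed (rule restrict_tuples, simp)
    then show "((\<lambda>t. f (?c (x(i := t)))) has_field_derivative h x) (at (x i))"
      using h(2) x by simp
  qed
qed

lemma smooth_closure_imp_smooth:
  assumes "smooth_closure n f"
  shows "restrict f (Rn n) \<in> smooth_funs n"
  using assms smooth_closure_continuous smooth_closure_deriv
  by (intro smooth_funs_coinduct[where S = "Collect (smooth_closure n)"]) auto

lemma smooth_funs_add:
  "f \<in> smooth_funs n \<Longrightarrow> g \<in> smooth_funs n \<Longrightarrow> (\<lambda>x\<in>Rn n. f x + g x) \<in> smooth_funs n"
  by (intro smooth_closure_imp_smooth smooth_closure.intros)

lemma smooth_funs_mult:
  "f \<in> smooth_funs n \<Longrightarrow> g \<in> smooth_funs n \<Longrightarrow> (\<lambda>x\<in>Rn n. f x * g x) \<in> smooth_funs n"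
  by (intro smooth_closure_imp_smooth smooth_closure.intros)

lemma smooth_funs_comp:
  assumes "f \<in> smooth_funs m" "\<And>i. i < m \<Longrightarrow> g i \<in> smooth_funs n"
  shows "(\<lambda>x\<in>Rn n. f (\<lambda>i\<in>{..<m}. g i x)) \<in> smooth_funs n"
  using assms by (intro smooth_closure_imp_smooth smooth_closure.comp)

lemma smooth_funs_uminus:
  assumes "f \<in> smooth_funs n"
  shows "(\<lambda>x\<in>Rn n. - f x) \<in> smooth_funs n"
proof -
  have "(\<lambda>x\<in>Rn n. - f x) = (\<lambda>x\<in>Rn n. (\<lambda>x\<in>Rn n. - 1) x * f x)" by auto
  then show ?thesis
    using smooth_funs_mult[OF smooth_funs_const assms] by metis
qed

lemma smooth_funs_diff:
  assumes "f \<in> smooth_funs n" "g \<in> smooth_funs n"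
  shows "(\<lambda>x\<in>Rn n. f x - g x) \<in> smooth_funs n"
proof -
  have "(\<lambda>x\<in>Rn n. f x - g x) = (\<lambda>x\<in>Rn n. f x + (\<lambda>x\<in>Rn n. - g x) x)" by auto
  then show ?thesis
    using smooth_funs_add[OF assms(1) smooth_funs_uminus[OF assms(2)]] by metis
qed

section \<open>Integrals with parameters and Hadamard's lemma\<close>

text \<open>The last coordinate becomes the integration variable; continuity of a parameter integral
  requires joint continuity in this form.\<close>

lemma continuous_on_fun_upd_pair:
  fixes F :: "(nat \<Rightarrow> real) \<Rightarrow> real"
  assumes "continuous_on (Rn (Suc m)) F"
  shows "continuous_on (Rn m \<times> T) (\<lambda>(x, t). F (x(m := t)))"
proof -
  have "continuous_on (Rn m \<times> T) (\<lambda>p. (fst p)(m := snd p))"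
  proof (rule continuous_on_coordinatewise_then_product)
    show "continuous_on (Rn m \<times> T) (\<lambda>p. ((fst p)(m := snd p)) j)" for j
    proof (cases "j = m")
      case False
      then show ?thesis
        using continuous_on_product_then_coordinatewise[OF continuous_on_fst[OF continuous_on_id]]
        by simp
    qed (auto intro: continuous_on_snd continuous_on_id)
  qed
  then show ?thesis
    unfolding case_prod_unfold
    by (rule continuous_on_compose2[OF assms]) (use tuples_fun_upd_Suc in force)
qed

text \<open>The coinduction set consists of all parameter integrals of smooth integrands. By the
  Leibniz rule, a derivative in a direction \<open>i < m\<close> replaces the integrand by its
  partial derivative, which is smooth in all \<open>m + 1\<close> variables, so the set is closed
  under differentiation.\<close>

lemma smooth_funs_integral:
  assumes "F \<in> smooth_funs (Suc m)"
  shows "(\<lambda>x\<in>Rn m. integral {0..1} (\<lambda>t. F (x(m := t)))) \<in> smooth_funs m"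
proof (rule smooth_funs_coinduct)
  let ?I = "\<lambda>F x. integral {0..1} (\<lambda>t. F (x(m := t)))"
  let ?S = "{f. \<exists>F\<in>smooth_funs (Suc m). \<forall>x\<in>Rn m. f x = ?I F x}"
  show "?I F \<in> ?S" using assms by auto
  show "continuous_on (Rn m) f" if "f \<in> ?S" for f
  proof -
    obtain F where F: "F \<in> smooth_funs (Suc m)" "\<forall>x\<in>Rn m. f x = ?I F x"
      using \<open>f \<in> ?S\<close> unfolding mem_Collect_eq by (elim bexE)
    have "continuous_on (Rn m) (?I F)"
      using integral_continuous_on_param[of "Rn m" 0 1 "\<lambda>x t. F (x(m := t))"]
        continuous_on_fun_upd_pair[OF smooth_funs_continuous[OF F(1)]] by simp
    then show ?thesis using F(2) by (metis (no_types, lifting) continuous_on_cong)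
  qed
  show "\<exists>g\<in>?S. \<forall>x\<in>Rn m. ((\<lambda>t. f (x(i := t))) has_field_derivative g x) (at (x i))"
    if "f \<in> ?S" and i: "i < m" for f i
  proof -
    obtain F where F: "F \<in> smooth_funs (Suc m)" "\<And>x. x \<in> Rn m \<Longrightarrow> f x = ?I F x"
      using \<open>f \<in> ?S\<close> unfolding mem_Collect_eq by (elim bexE) metis
    let ?F' = "restrict (partial_deriv i F) (Rn (Suc m))"
    have F': "?F' \<in> smooth_funs (Suc m)"
      using F(1) i by (intro partial_deriv_smooth_funs) auto
    show ?thesis
    proof (intro bexI[of _ "?I ?F'"] ballI)
      show "?I ?F' \<in> ?S" using F' by blast
      fix x assume x: "x \<in> Rn m"
      \<comment> \<open>All coordinates of \<open>x\<close> except \<open>i\<close> are fixed, which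
        leaves a one-parameter integral in \<open>s\<close>; \<open>x(i := x i)\<close> is
        \<open>x\<close> itself.\<close>
      have "((\<lambda>s. integral (cbox 0 1) (\<lambda>t. F (x(i := s, m := t)))) has_field_derivative
          integral (cbox 0 1) (\<lambda>t. ?F' (x(i := x i, m := t)))) (at (x i) within UNIV)"
      proof (rule leibniz_rule_field_derivative)
        show "((\<lambda>s. F (x(i := s, m := t))) has_field_derivative ?F' (x(i := s, m := t)))
            (at s within UNIV)" for s t
        proof -
          have "x(i := s, m := t) \<in> Rn (Suc m)" using x i by auto
          moreover have "(x(i := s, m := t))(i := u) = x(i := u, m := t)" for u
            using i by (auto simp: fun_eq_iff)
          ultimately show ?thesis
            using smooth_funs_has_partial_deriv[OF F(1), of i "x(i := s, m := t)"] i by simp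
        qed
        have cont: "continuous_on (UNIV \<times> cbox 0 1) (\<lambda>(s, t). G (x(i := s, m := t)))"
          if "G \<in> smooth_funs (Suc m)" for G
        proof -
          have "continuous_on (UNIV \<times> cbox 0 (1::real)) (\<lambda>p. x(i := fst p, m := snd p))"
          proof (rule continuous_on_coordinatewise_then_product)
            show "continuous_on (UNIV \<times> cbox 0 (1::real)) (\<lambda>p. (x(i := fst p, m := snd p)) j)" for j
              by (cases "j = m"; cases "j = i")
                (auto intro: continuous_on_snd continuous_on_fst continuous_on_id)
          qed
          moreover have "(\<lambda>p. x(i := fst p, m := snd p)) ` (UNIV \<times> cbox 0 1) \<subseteq> Rn (Suc m)"
            using x i by (intro image_subsetI tuples_fun_upd_Suc tuples_fun_upd) simp_all
          ultimately show ?thesis unfolding case_prod_unfold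
            by (intro continuous_on_compose2[OF smooth_funs_continuous[OF that]])
        qed
        show "continuous_on (UNIV \<times> cbox 0 1) (\<lambda>(s, t). ?F' (x(i := s, m := t)))"
          by (rule cont[OF F'])
        show "(\<lambda>t. F (x(i := s, m := t))) integrable_on cbox 0 1" for s
        proof (rule integrable_continuous)
          show "continuous_on (cbox 0 1) (\<lambda>t. F (x(i := s, m := t)))"
            using continuous_on_compose2[OF cont[OF F(1)], of "cbox 0 1" "Pair s"]
            by (simp add: image_subset_iff continuous_on_Pair continuous_on_const continuous_on_id)
        qed
      qed auto
      moreover have "(\<lambda>s. f (x(i := s))) = (\<lambda>s. integral {0..1} (\<lambda>t. F (x(i := s, m := t))))"
        using x i by (intro ext F(2)) auto
      ultimately show "((\<lambda>t. f (x(i := t))) has_field_derivative ?I ?F' x) (at (x i))"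
        by simp
    qed
  qed
qed

text \<open>This is the fundamental theorem of calculus on the segment from \<open>x(i := s)\<close>
  to \<open>x\<close>, parametrised by \<open>t\<close> in \<open>[0,1]\<close>: the inner
  derivative \<open>x i - s\<close> is constant in \<open>t\<close> and leaves the integral as a
  factor.\<close>

lemma hadamard_one_variable:
  assumes f: "f \<in> smooth_funs n" and i: "i < n"
  shows "\<exists>g\<in>smooth_funs (Suc n). \<forall>x\<in>Rn n. \<forall>s. f x - f (x(i := s)) = (x i - s) * g (x(n := s))"
proof -
  let ?N = "Suc (Suc n)"
  let ?p = "\<lambda>k. \<lambda>w\<in>Rn ?N. w k :: real"
  let ?f' = "restrict (partial_deriv i f) (Rn n)"
  \<comment> \<open>The coordinates \<open>n\<close> and \<open>Suc n\<close> of \<open>w\<close> stand for \<open>s\<close> and the integration variable.\<close>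
  define q where "q = (\<lambda>w\<in>Rn ?N. w n + w (Suc n) * (w i - w n))"
  have q: "q \<in> smooth_funs ?N"
  proof -
    \<comment> \<open>The nested restrictions give \<open>q\<close> the literal shape to which the
      closure rules for smooth functions apply.\<close>
    have "q = (\<lambda>w\<in>Rn ?N. ?p n w + (\<lambda>w\<in>Rn ?N. ?p (Suc n) w * (\<lambda>w\<in>Rn ?N. ?p i w - ?p n w) w) w)"
      by (auto simp: q_def)
    then show ?thesis
      using i by (auto intro!: smooth_funs_add smooth_funs_mult smooth_funs_diff smooth_funs_proj simp del: restrict_apply)
  qed
  define F where "F = (\<lambda>w\<in>Rn ?N. ?f' (\<lambda>j\<in>{..<n}. (if j = i then q else ?p j) w))"
  have F: "F \<in> smooth_funs ?N"
    unfolding F_def using f i q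
    by (intro smooth_funs_comp) (auto intro: partial_deriv_smooth_funs smooth_funs_proj
      simp del: restrict_apply)
  let ?G = "\<lambda>z\<in>Rn (Suc n). integral {0..1} (\<lambda>t. F (z(Suc n := t)))"
  show ?thesis
  proof (intro bexI[of _ ?G] ballI allI smooth_funs_integral F)
    fix x :: "nat \<Rightarrow> real" and s assume x: "x \<in> Rn n"
    have eq: "F (x(n := s, Suc n := t)) = ?f' (x(i := s + t * (x i - s)))" for t
    proof -
      have "x(n := s, Suc n := t) \<in> Rn ?N" using x by auto
      moreover have "(\<lambda>j\<in>{..<n}. (if j = i then q else ?p j) (x(n := s, Suc n := t))) =
          x(i := s + t * (x i - s))"
        using x i calculation by (auto simp: q_def fun_eq_iff PiE_iff extensional_def)
      moreover have "x(i := s + t * (x i - s)) \<in> Rn n" using x i by auto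
      ultimately show ?thesis by (simp only: F_def restrict_apply' if_True)
    qed
    \<comment> \<open>The endpoints are kept as instances of \<open>s + t * (x i - s)\<close>:
      \<open>t = 1\<close> gives \<open>x\<close> and \<open>t = 0\<close> gives
      \<open>x(i := s)\<close>.\<close>
    have "((\<lambda>t. (x i - s) * F (x(n := s, Suc n := t))) has_integral
        f (x(i := s + 1 * (x i - s))) - f (x(i := s + 0 * (x i - s)))) {0..1}"
    proof (rule fundamental_theorem_of_calculus)
      fix t :: real
      have xt: "x(i := s + t * (x i - s)) \<in> Rn n" using x i by auto
      have "((\<lambda>u. f (x(i := u))) has_field_derivative ?f' (x(i := s + t * (x i - s))))
          (at (s + t * (x i - s)))"
        using smooth_funs_has_partial_deriv[OF f i xt] xt by simp
      moreover have "((\<lambda>t. s + t * (x i - s)) has_field_derivative (x i - s)) (at t)"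
        by (auto intro!: derivative_eq_intros)
      ultimately have "((\<lambda>t. f (x(i := s + t * (x i - s)))) has_field_derivative
          ?f' (x(i := s + t * (x i - s))) * (x i - s)) (at t)"
        by (rule DERIV_chain2)
      then show "((\<lambda>t. f (x(i := s + t * (x i - s)))) has_vector_derivative
          (x i - s) * F (x(n := s, Suc n := t))) (at t within {0..1})"
        unfolding eq by (simp add: has_real_derivative_iff_has_vector_derivative mult.commute
            has_vector_derivative_at_within)
    qed simp
    from integral_unique[OF this] show "f x - f (x(i := s)) = (x i - s) * ?G (x(n := s))"
      using x by simp
  qed
qed

section \<open>The commutative ring underlying a C-infinity ring\<close>

lemma tuple_in_tuples [simp]: "set xs \<subseteq> A \<Longrightarrow> n = length xs \<Longrightarrow> tuple xs \<in> tuples n A"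
  by (auto simp: tuple_def)

lemma tuple_nth [simp]: "i < length xs \<Longrightarrow> tuple xs i = xs ! i"
  by (simp add: tuple_def)

lemma restrict_lessThan_0: "(\<lambda>i\<in>{..<0::nat}. g i) = tuple []"
  by (auto simp: tuple_def)

lemma restrict_lessThan_2: "(\<lambda>i\<in>{..<2}. g i) = tuple [g 0, g 1]"
  by (auto simp: tuple_def fun_eq_iff nth_Cons less_2_cases_iff split: nat.split)

locale cinfinity_ring =
  fixes A :: "'a set" and \<Phi> :: "'a cinf_map"
  assumes cinf: "cinf_ring A \<Phi>"
begin

abbreviation R :: "'a ring" where "R \<equiv> ring_of_cinf A \<Phi>"

lemma carrier_R [simp]: "carrier R = A"
  by (simp add: ring_of_cinf_def)

lemma Phi_closed [simp, intro]: "f \<in> smooth_funs n \<Longrightarrow> a \<in> tuples n A \<Longrightarrow> \<Phi> n f a \<in> A"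
  using cinf by (simp add: cinf_ring_def cinf_structure_def Pi_iff)

lemma Phi_proj: "k < n \<Longrightarrow> a \<in> tuples n A \<Longrightarrow> \<Phi> n (\<lambda>x\<in>Rn n. x k) a = a k"
  using cinf by (simp add: cinf_ring_def)

text \<open>The composition axiom speaks about any smooth \<open>h\<close> that agrees with the
  composite. Closure of smooth functions under composition allows the restricted composite itself to
  be taken as \<open>h\<close>.\<close>

lemma Phi_comp:
  assumes "f \<in> smooth_funs n" "\<And>i. i < n \<Longrightarrow> g i \<in> smooth_funs k" "a \<in> tuples k A"
  shows "\<Phi> k (\<lambda>x\<in>Rn k. f (\<lambda>i\<in>{..<n}. g i x)) a = \<Phi> n f (\<lambda>i\<in>{..<n}. \<Phi> k (g i) a)"
proof -
  have comp: "\<And>n k f g h.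
      f \<in> smooth_funs n \<longrightarrow> (\<forall>i<n. g i \<in> smooth_funs k) \<longrightarrow> h \<in> smooth_funs k \<longrightarrow>
      (\<forall>x\<in>Rn k. h x = f (\<lambda>i\<in>{..<n}. g i x)) \<longrightarrow>
      (\<forall>a\<in>tuples k A. \<Phi> k h a = \<Phi> n f (\<lambda>i\<in>{..<n}. \<Phi> k (g i) a))"
    using cinf unfolding cinf_ring_def by (elim conjE) metis
  show ?thesis
    by (rule comp[rule_format]) (use assms smooth_funs_comp[OF assms(1,2)] in simp_all)
qed

text \<open>A constant function on \<open>R^n\<close> factors through \<open>R^0\<close>. The
  composition axiom with an empty family of inner functions then removes the dependence on
  \<open>a\<close>; the zero functions that appear in the proof only fill this empty family.\<close>

lemma Phi_const:
  assumes "a \<in> tuples n A"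
  shows "\<Phi> n (\<lambda>x\<in>Rn n. c) a = \<Phi> 0 (\<lambda>x\<in>Rn 0. c) (tuple [])"
proof -
  have "\<Phi> n (\<lambda>x\<in>Rn n. (\<lambda>x\<in>Rn 0. c) (\<lambda>i\<in>{..<0}. 0)) a =
      \<Phi> 0 (\<lambda>x\<in>Rn 0. c) (\<lambda>i\<in>{..<0}. \<Phi> n (\<lambda>x. 0) a)"
    by (rule Phi_comp[OF smooth_funs_const _ assms]) simp
  moreover have "(\<lambda>x\<in>Rn n. (\<lambda>x\<in>Rn 0. c) (\<lambda>i\<in>{..<0}. 0)) = (\<lambda>x\<in>Rn n. c)"
    by (intro restrict_ext restrict_apply' restrict_tuples) simp
  ultimately show ?thesis
    by (simp only: restrict_lessThan_0)
qed

lemma Phi_zero: "a \<in> tuples n A \<Longrightarrow> \<Phi> n (\<lambda>x\<in>Rn n. 0) a = \<zero>\<^bsub>R\<^esub>"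
  by (simp add: Phi_const ring_of_cinf_def)

lemma Phi_one: "a \<in> tuples n A \<Longrightarrow> \<Phi> n (\<lambda>x\<in>Rn n. 1) a = \<one>\<^bsub>R\<^esub>"
  by (simp add: Phi_const ring_of_cinf_def)

text \<open>The composition axiom for two inner functions; \<open>F\<close> is curried so that
  addition and multiplication are instances.\<close>

lemma Phi_binary:
  assumes F: "(\<lambda>x\<in>Rn 2. F (x 0) (x 1)) \<in> smooth_funs 2"
    and fg: "f \<in> smooth_funs n" "g \<in> smooth_funs n" and a: "a \<in> tuples n A"
  shows "\<Phi> n (\<lambda>x\<in>Rn n. F (f x) (g x)) a =
    \<Phi> 2 (\<lambda>x\<in>Rn 2. F (x 0) (x 1)) (tuple [\<Phi> n f a, \<Phi> n g a])"
proof -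
  have "\<Phi> n (\<lambda>x\<in>Rn n. (\<lambda>x\<in>Rn 2. F (x 0) (x 1)) (\<lambda>i\<in>{..<2}. (if i = 0 then f else g) x)) a =
    \<Phi> 2 (\<lambda>x\<in>Rn 2. F (x 0) (x 1)) (\<lambda>i\<in>{..<2}. \<Phi> n (if i = 0 then f else g) a)"
    using fg by (intro Phi_comp[OF F _ a]) auto
  then show ?thesis
    by (simp only: restrict_lessThan_2) simp
qed

lemma smooth_funs_plus2: "(\<lambda>x\<in>Rn 2. x 0 + x 1) \<in> smooth_funs 2"
  using smooth_funs_add[OF smooth_funs_proj[of 0 2] smooth_funs_proj[of 1 2]]
  by (simp cong: restrict_cong)

lemma smooth_funs_times2: "(\<lambda>x\<in>Rn 2. x 0 * x 1) \<in> smooth_funs 2"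
  using smooth_funs_mult[OF smooth_funs_proj[of 0 2] smooth_funs_proj[of 1 2]]
  by (simp cong: restrict_cong)

lemma Phi_add:
  assumes "f \<in> smooth_funs n" "g \<in> smooth_funs n" "a \<in> tuples n A"
  shows "\<Phi> n (\<lambda>x\<in>Rn n. f x + g x) a = \<Phi> n f a \<oplus>\<^bsub>R\<^esub> \<Phi> n g a"
  using Phi_binary[OF smooth_funs_plus2 assms] by (simp add: ring_of_cinf_def)

lemma Phi_mult:
  assumes "f \<in> smooth_funs n" "g \<in> smooth_funs n" "a \<in> tuples n A"
  shows "\<Phi> n (\<lambda>x\<in>Rn n. f x * g x) a = \<Phi> n f a \<otimes>\<^bsub>R\<^esub> \<Phi> n g a"
  using Phi_binary[OF smooth_funs_times2 assms] by (simp add: ring_of_cinf_def)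

lemma Phi_represent_three:
  assumes "x \<in> A" "y \<in> A" "z \<in> A"
  obtains a f g h where "a \<in> tuples 3 A"
    "f \<in> smooth_funs 3" "g \<in> smooth_funs 3" "h \<in> smooth_funs 3"
    "x = \<Phi> 3 f a" "y = \<Phi> 3 g a" "z = \<Phi> 3 h a"
proof
  show a: "tuple [x, y, z] \<in> tuples 3 A"
    using assms by simp
  show "x = \<Phi> 3 (\<lambda>x\<in>Rn 3. x 0) (tuple [x, y, z])" "y = \<Phi> 3 (\<lambda>x\<in>Rn 3. x 1) (tuple [x, y, z])"
    "z = \<Phi> 3 (\<lambda>x\<in>Rn 3. x 2) (tuple [x, y, z])"
    using Phi_proj[OF _ a] by simp_all
qed (simp_all add: smooth_funs_proj)

text \<open>
  Three arbitrary elements are the values of coordinate functions at a common tuple, so each ring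
  axiom reduces to the same identity between real functions.
\<close>

lemma cring_R: "cring R"
proof (intro cringI abelian_groupI comm_monoidI; simp only: carrier_R)
  note smooth = smooth_funs_add smooth_funs_mult smooth_funs_const
  note hom = Phi_add[symmetric] Phi_mult[symmetric]
  fix x y z assume "x \<in> A" "y \<in> A" "z \<in> A"
  then obtain a f g h where a: "a \<in> tuples 3 A"
    and fgh: "f \<in> smooth_funs 3" "g \<in> smooth_funs 3" "h \<in> smooth_funs 3"
    and xyz: "x = \<Phi> 3 f a" "y = \<Phi> 3 g a" "z = \<Phi> 3 h a"
    by (rule Phi_represent_three)
  have eqI: "\<Phi> 3 (restrict u (Rn 3)) a = \<Phi> 3 (restrict v (Rn 3)) a"
    if "\<And>x. x \<in> Rn 3 \<Longrightarrow> u x = v x" for u v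
    using that by (metis restrict_ext)
  show "x \<oplus>\<^bsub>R\<^esub> y \<in> A" "x \<otimes>\<^bsub>R\<^esub> y \<in> A"
    using a fgh by (simp_all only: xyz hom smooth Phi_closed)
  show "x \<oplus>\<^bsub>R\<^esub> y \<oplus>\<^bsub>R\<^esub> z = x \<oplus>\<^bsub>R\<^esub> (y \<oplus>\<^bsub>R\<^esub> z)"
    using a fgh by (simp only: xyz hom smooth) (rule eqI, simp)
  show "x \<oplus>\<^bsub>R\<^esub> y = y \<oplus>\<^bsub>R\<^esub> x"
    using a fgh by (simp only: xyz hom smooth) (rule eqI, simp)
  show "x \<otimes>\<^bsub>R\<^esub> y \<otimes>\<^bsub>R\<^esub> z = x \<otimes>\<^bsub>R\<^esub> (y \<otimes>\<^bsub>R\<^esub> z)"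
    using a fgh by (simp only: xyz hom smooth) (rule eqI, simp)
  show "x \<otimes>\<^bsub>R\<^esub> y = y \<otimes>\<^bsub>R\<^esub> x"
    using a fgh by (simp only: xyz hom smooth) (rule eqI, simp)
  show "(x \<oplus>\<^bsub>R\<^esub> y) \<otimes>\<^bsub>R\<^esub> z = x \<otimes>\<^bsub>R\<^esub> z \<oplus>\<^bsub>R\<^esub> y \<otimes>\<^bsub>R\<^esub> z"
    using a fgh by (simp only: xyz hom smooth) (rule eqI, simp add: algebra_simps)
next
  fix x assume "x \<in> A"
  then obtain a f where a: "a \<in> tuples 3 A" and f: "f \<in> smooth_funs 3" and x: "x = \<Phi> 3 f a"
    by (metis Phi_represent_three)
  have "\<Phi> 3 (\<lambda>x\<in>Rn 3. (\<lambda>x\<in>Rn 3. 0) x + f x) a = \<zero>\<^bsub>R\<^esub> \<oplus>\<^bsub>R\<^esub> x"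
    using Phi_add[OF smooth_funs_const f a] Phi_zero[OF a] x by simp
  moreover have "(\<lambda>x\<in>Rn 3. (\<lambda>x\<in>Rn 3. 0) x + f x) = restrict f (Rn 3)"
    by auto
  ultimately show "\<zero>\<^bsub>R\<^esub> \<oplus>\<^bsub>R\<^esub> x = x"
    using f x by simp
  have "\<Phi> 3 (\<lambda>x\<in>Rn 3. (\<lambda>x\<in>Rn 3. 1) x * f x) a = \<one>\<^bsub>R\<^esub> \<otimes>\<^bsub>R\<^esub> x"
    using Phi_mult[OF smooth_funs_const f a] Phi_one[OF a] x by simp
  moreover have "(\<lambda>x\<in>Rn 3. (\<lambda>x\<in>Rn 3. 1) x * f x) = restrict f (Rn 3)"
    by auto
  ultimately show "\<one>\<^bsub>R\<^esub> \<otimes>\<^bsub>R\<^esub> x = x"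
    using f x by simp
  \<comment> \<open>The additive inverse of the value of \<open>f\<close> is the value of
    \<open>- f\<close> at the same tuple.\<close>
  have "\<Phi> 3 (\<lambda>x\<in>Rn 3. (\<lambda>x\<in>Rn 3. - f x) x + f x) a = \<Phi> 3 (\<lambda>x\<in>Rn 3. - f x) a \<oplus>\<^bsub>R\<^esub> x"
    using Phi_add[OF smooth_funs_uminus[OF f] f a] x by simp
  moreover have "(\<lambda>x\<in>Rn 3. (\<lambda>x\<in>Rn 3. - f x) x + f x) = (\<lambda>x\<in>Rn 3. 0)"
    by auto
  ultimately show "\<exists>y\<in>A. y \<oplus>\<^bsub>R\<^esub> x = \<zero>\<^bsub>R\<^esub>"
    using Phi_zero[OF a] Phi_closed[OF smooth_funs_uminus[OF f] a] by metis
next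
  have "tuple [] \<in> tuples 0 A" by (rule tuple_in_tuples) simp_all
  then show "\<zero>\<^bsub>R\<^esub> \<in> A" "\<one>\<^bsub>R\<^esub> \<in> A"
    using Phi_closed smooth_funs_const Phi_zero Phi_one by metis+
qed

end

sublocale cinfinity_ring \<subseteq> R: cring R
  by (rule cring_R)

context cinfinity_ring
begin

lemmas R_closed [simp] =
  R.a_closed[unfolded carrier_R] R.m_closed[unfolded carrier_R] R.zero_closed[unfolded carrier_R]
  R.a_inv_closed[unfolded carrier_R] R.minus_closed[unfolded carrier_R]

text \<open>Subtraction in the ring is defined through additive inverses, not through
  \<open>\<Phi>\<close>. The two agree because \<open>(f - g) + g = f\<close> transfers and inverses
  are unique.\<close>

lemma Phi_diff:
  assumes "f \<in> smooth_funs n" "g \<in> smooth_funs n" "a \<in> tuples n A"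
  shows "\<Phi> n (\<lambda>x\<in>Rn n. f x - g x) a = \<Phi> n f a \<ominus>\<^bsub>R\<^esub> \<Phi> n g a"
proof -
  have "(\<lambda>x\<in>Rn n. (\<lambda>x\<in>Rn n. f x - g x) x + g x) = restrict f (Rn n)" by auto
  then have "\<Phi> n (\<lambda>x\<in>Rn n. f x - g x) a \<oplus>\<^bsub>R\<^esub> \<Phi> n g a = \<Phi> n f a"
    using Phi_add[OF smooth_funs_diff[OF assms(1,2)] assms(2,3)] assms(1) by simp
  moreover have "\<Phi> n (\<lambda>x\<in>Rn n. f x - g x) a \<in> carrier R" "\<Phi> n g a \<in> carrier R"
    using assms smooth_funs_diff by auto
  ultimately show ?thesis
    by (metis R.add.inv_solve_right R.minus_eq R.add.m_closed)
qed

section \<open>Transfer of Hadamard's lemma and the congruence of an ideal\<close>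

text \<open>Hadamard's identity is evaluated at \<open>a(n := b)\<close>, where the extra coordinate
  carries the new value \<open>b\<close>; the cofactor \<open>c\<close> is the value of
  \<open>g\<close> there. It is this multiple that an ideal containing \<open>a i - b\<close>
  absorbs.\<close>

lemma Phi_fun_upd_diff:
  assumes f: "f \<in> smooth_funs n" and i: "i < n" and a: "a \<in> tuples n A" and b: "b \<in> A"
  shows "\<exists>c\<in>A. \<Phi> n f a \<ominus>\<^bsub>R\<^esub> \<Phi> n f (a(i := b)) = (a i \<ominus>\<^bsub>R\<^esub> b) \<otimes>\<^bsub>R\<^esub> c"
proof -
  let ?N = "Suc n"
  let ?p = "\<lambda>k. \<lambda>x\<in>Rn ?N. x k :: real"
  obtain g where g: "g \<in> smooth_funs ?N"
    and fg: "\<And>x s. x \<in> Rn n \<Longrightarrow> f x - f (x(i := s)) = (x i - s) * g (x(n := s))"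
    using hadamard_one_variable[OF f i] by auto
  \<comment> \<open>Both terms of the difference become functions of \<open>n + 1\<close> variables:
    \<open>?u\<close> ignores the last one, and \<open>?v\<close> puts it in position
    \<open>i\<close>.\<close>
  let ?u = "\<lambda>x\<in>Rn ?N. f (\<lambda>j\<in>{..<n}. ?p j x)"
  let ?v = "\<lambda>x\<in>Rn ?N. f (\<lambda>j\<in>{..<n}. ?p (if j = i then n else j) x)"
  let ?a = "a(n := b)"
  have p: "?p k \<in> smooth_funs ?N" if "k \<le> n" for k
    using that by (simp add: smooth_funs_proj)
  have uv: "?u \<in> smooth_funs ?N" "?v \<in> smooth_funs ?N"
    by (rule smooth_funs_comp[OF f], rule p, simp)+
  have a': "?a \<in> tuples ?N A"
    using a b by (rule tuples_fun_upd_Suc)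
  have proj: "\<Phi> ?N (?p k) ?a = ?a k" if "k \<le> n" for k
    using that by (intro Phi_proj a') simp
  have "\<Phi> ?N ?u ?a = \<Phi> n f (\<lambda>j\<in>{..<n}. \<Phi> ?N (?p j) ?a)"
    by (intro Phi_comp f a' p) simp
  also have "(\<lambda>j\<in>{..<n}. \<Phi> ?N (?p j) ?a) = (\<lambda>j\<in>{..<n}. ?a j)"
    by (intro restrict_ext proj) simp
  also have "\<dots> = a"
    using a by (auto simp: fun_eq_iff PiE_iff extensional_def)
  finally have u: "\<Phi> ?N ?u ?a = \<Phi> n f a" .
  have "\<Phi> ?N ?v ?a = \<Phi> n f (\<lambda>j\<in>{..<n}. \<Phi> ?N (?p (if j = i then n else j)) ?a)"
    by (intro Phi_comp f a' p) simp
  also have "(\<lambda>j\<in>{..<n}. \<Phi> ?N (?p (if j = i then n else j)) ?a) =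
      (\<lambda>j\<in>{..<n}. ?a (if j = i then n else j))"
    by (intro restrict_ext proj) simp
  also have "\<dots> = a(i := b)"
    using a i by (auto simp: fun_eq_iff PiE_iff extensional_def)
  finally have v: "\<Phi> ?N ?v ?a = \<Phi> n f (a(i := b))" .
  \<comment> \<open>Hadamard's identity at the first \<open>n\<close> coordinates of
    \<open>x\<close>, with \<open>s\<close> equal to the last one.\<close>
  have eq: "(\<lambda>x\<in>Rn ?N. ?u x - ?v x) = (\<lambda>x\<in>Rn ?N. (\<lambda>x\<in>Rn ?N. ?p i x - ?p n x) x * g x)"
  proof (rule restrict_ext)
    fix x :: "nat \<Rightarrow> real" assume x: "x \<in> Rn ?N"
    let ?y = "\<lambda>j\<in>{..<n}. x j"
    have "(\<lambda>j\<in>{..<n}. ?p (if j = i then n else j) x) = ?y(i := x n)"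
      using x i by (auto simp: fun_eq_iff)
    moreover have "(\<lambda>j\<in>{..<n}. ?p j x) = ?y"
      using x by (auto simp: fun_eq_iff)
    moreover have "?y(n := x n) = x"
      using x by (auto simp: fun_eq_iff PiE_iff extensional_def)
    moreover have "?y \<in> Rn n" by auto
    ultimately show "?u x - ?v x = (\<lambda>x\<in>Rn ?N. ?p i x - ?p n x) x * g x"
      using fg[of ?y "x n"] x i by (simp only: restrict_apply') simp
  qed
  have "\<Phi> n f a \<ominus>\<^bsub>R\<^esub> \<Phi> n f (a(i := b)) = \<Phi> ?N (\<lambda>x\<in>Rn ?N. ?u x - ?v x) ?a"
    unfolding Phi_diff[OF uv a'] u v ..
  also have "\<dots> = \<Phi> ?N (\<lambda>x\<in>Rn ?N. ?p i x - ?p n x) ?a \<otimes>\<^bsub>R\<^esub> \<Phi> ?N g ?a"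
    unfolding eq using i by (intro Phi_mult smooth_funs_diff p g a') simp_all
  also have "\<Phi> ?N (\<lambda>x\<in>Rn ?N. ?p i x - ?p n x) ?a = \<Phi> ?N (?p i) ?a \<ominus>\<^bsub>R\<^esub> \<Phi> ?N (?p n) ?a"
    using i by (intro Phi_diff p a') simp_all
  also have "\<dots> = a i \<ominus>\<^bsub>R\<^esub> b"
    using i by (simp only: proj less_imp_le order_refl) simp
  finally show ?thesis
    using Phi_closed[OF g a'] by blast
qed

lemma ideal_congruence:
  assumes "ideal I R"
  defines "S \<equiv> {(a, b). a \<in> A \<and> b \<in> A \<and> a \<ominus>\<^bsub>R\<^esub> b \<in> I}"
  shows "S \<in> cinf_congruences A \<Phi>"
proof -
  interpret I: ideal I R by fact
  have equiv: "equiv A S"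
  proof (rule equivI)
    show "S \<subseteq> A \<times> A" by (auto simp: S_def)
    show "refl_on A S"
      using I.zero_closed by (auto simp: S_def refl_on_def R.r_neg R.minus_eq)
    show "sym S"
    proof (rule symI)
      fix a b assume "(a, b) \<in> S"
      then have ab: "a \<in> A" "b \<in> A" "a \<ominus>\<^bsub>R\<^esub> b \<in> I" by (auto simp: S_def)
      then have "b \<ominus>\<^bsub>R\<^esub> a = \<ominus>\<^bsub>R\<^esub> (a \<ominus>\<^bsub>R\<^esub> b)"
        by (simp add: R.minus_eq R.minus_add R.a_comm)
      then show "(b, a) \<in> S" using ab I.a_inv_closed by (simp add: S_def)
    qed
    show "trans S"
    proof (rule transI)
      fix a b c assume "(a, b) \<in> S" "(b, c) \<in> S"
      then have abc: "a \<in> A" "b \<in> A" "c \<in> A" "a \<ominus>\<^bsub>R\<^esub> b \<in> I" "b \<ominus>\<^bsub>R\<^esub> c \<in> I"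
        by (auto simp: S_def)
      then have "a \<ominus>\<^bsub>R\<^esub> c = (a \<ominus>\<^bsub>R\<^esub> b) \<oplus>\<^bsub>R\<^esub> (b \<ominus>\<^bsub>R\<^esub> c)"
        by (simp add: R.minus_eq R.a_assoc R.r_neg1 R.r_neg2)
      then show "(a, c) \<in> S" using abc I.a_closed by (simp add: S_def)
    qed
  qed
  have "(\<Phi> n f x, \<Phi> n f y) \<in> S"
    if f: "f \<in> smooth_funs n" and x: "x \<in> tuples n A" and y: "y \<in> tuples n A"
      and xy: "\<And>i. i < n \<Longrightarrow> (x i, y i) \<in> S" for n f x y
  proof -
    define P where "P k = (\<lambda>j. if j < k then y j else x j)" for k
    have P: "P k \<in> tuples n A" for k
      using x y by (auto simp: P_def PiE_iff extensional_def)
    have P_Suc: "P (Suc k) = (P k)(k := y k)" for k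
      by (auto simp: P_def fun_eq_iff less_Suc_eq)
    have "(\<Phi> n f x, \<Phi> n f (P k)) \<in> S" if "k \<le> n" for k
      using that
    proof (induction k)
      case 0
      have "P 0 = x" by (simp add: P_def)
      then show ?case
        using equiv Phi_closed[OF f x] by (simp add: equiv_def refl_on_def)
    next
      case (Suc k)
      then have k: "k < n" by simp
      have yk: "y k \<in> A" using y k by auto
      obtain c where c: "c \<in> A"
        "\<Phi> n f (P k) \<ominus>\<^bsub>R\<^esub> \<Phi> n f (P (Suc k)) = (P k k \<ominus>\<^bsub>R\<^esub> y k) \<otimes>\<^bsub>R\<^esub> c"
        using Phi_fun_upd_diff[OF f k P[of k] yk] unfolding P_Suc by blast
      \<comment> \<open>Position \<open>k\<close> is not yet replaced in \<open>P k\<close>, so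
        \<open>P k k\<close> is \<open>x k\<close> and the hypothesis on \<open>x\<close> and
        \<open>y\<close> applies.\<close>
      moreover have "P k k \<ominus>\<^bsub>R\<^esub> y k \<in> I"
        using xy[OF k] by (simp add: P_def S_def)
      ultimately have "(\<Phi> n f (P k), \<Phi> n f (P (Suc k))) \<in> S"
        using I.I_r_closed Phi_closed[OF f P] by (simp add: S_def)
      then show ?case
        using Suc equiv by (meson Suc_leD equivE transE)
    qed
    from this[of n] show ?thesis
    proof -
      have "P n = y"
        using x y by (auto simp: P_def PiE_iff extensional_def fun_eq_iff)
      then show ?thesis using \<open>n \<le> n \<Longrightarrow> _\<close> by simp
    qed
  qed
  then show ?thesis
    using equiv by (auto simp: cinf_congruences_def)
qed

section \<open>The ideal of a congruence\<close>

lemma congruence_binary: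
  assumes "S \<in> cinf_congruences A \<Phi>" "f \<in> smooth_funs 2" "(a, b) \<in> S" "(c, d) \<in> S"
  shows "(\<Phi> 2 f (tuple [a, c]), \<Phi> 2 f (tuple [b, d])) \<in> S"
proof -
  have "S \<subseteq> A \<times> A"
    using assms(1) by (auto simp: cinf_congruences_def equiv_def)
  then have "tuple [a, c] \<in> tuples 2 A" "tuple [b, d] \<in> tuples 2 A"
    using assms(3,4) by (auto intro!: tuple_in_tuples)
  moreover have "\<forall>i<2. (tuple [a, c] i, tuple [b, d] i) \<in> S"
    using assms(3,4) by (auto simp: less_2_cases_iff)
  ultimately show ?thesis
    using assms(1,2) unfolding cinf_congruences_def by blast
qed

lemma congruence_add:
  assumes "S \<in> cinf_congruences A \<Phi>" "(a, b) \<in> S" "(c, d) \<in> S"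
  shows "(a \<oplus>\<^bsub>R\<^esub> c, b \<oplus>\<^bsub>R\<^esub> d) \<in> S"
  using congruence_binary[OF assms(1) smooth_funs_plus2 assms(2,3)] by (simp add: ring_of_cinf_def)

lemma congruence_mult:
  assumes "S \<in> cinf_congruences A \<Phi>" "(a, b) \<in> S" "(c, d) \<in> S"
  shows "(a \<otimes>\<^bsub>R\<^esub> c, b \<otimes>\<^bsub>R\<^esub> d) \<in> S"
  using congruence_binary[OF assms(1) smooth_funs_times2 assms(2,3)] by (simp add: ring_of_cinf_def)

lemma congruence_refl: "S \<in> cinf_congruences A \<Phi> \<Longrightarrow> a \<in> A \<Longrightarrow> (a, a) \<in> S"
  by (auto simp: cinf_congruences_def equiv_def refl_on_def)

lemma congruence_carrier: "S \<in> cinf_congruences A \<Phi> \<Longrightarrow> (a, b) \<in> S \<Longrightarrow> a \<in> A \<and> b \<in> A"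
  by (auto simp: cinf_congruences_def equiv_def)

text \<open>Reflexivity puts \<open>(-b, -b)\<close> and \<open>(b, b)\<close> into
  \<open>S\<close>. Adding the first pair to \<open>(a, b)\<close> gives one direction, and adding
  the second to \<open>(a - b, 0)\<close> gives the other.\<close>

lemma congruence_iff_diff:
  assumes S: "S \<in> cinf_congruences A \<Phi>" and ab: "a \<in> A" "b \<in> A"
  shows "(a, b) \<in> S \<longleftrightarrow> (a \<ominus>\<^bsub>R\<^esub> b, \<zero>\<^bsub>R\<^esub>) \<in> S"
proof
  assume "(a, b) \<in> S"
  from congruence_add[OF S this congruence_refl[OF S, of "\<ominus>\<^bsub>R\<^esub> b"]]
  show "(a \<ominus>\<^bsub>R\<^esub> b, \<zero>\<^bsub>R\<^esub>) \<in> S"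
    using ab R.a_inv_closed by (simp add: R.minus_eq R.r_neg)
next
  assume "(a \<ominus>\<^bsub>R\<^esub> b, \<zero>\<^bsub>R\<^esub>) \<in> S"
  from congruence_add[OF S this congruence_refl[OF S ab(2)]]
  show "(a, b) \<in> S"
    using ab R.a_inv_closed by (simp add: R.minus_eq R.a_assoc R.l_neg)
qed

text \<open>The closure properties hold because \<open>0 + 0 = 0\<close> and
  \<open>b * 0 = 0 * b = 0\<close>. For negation, symmetry gives \<open>(0, a)\<close> in
  \<open>S\<close>, and passing to the difference \<open>0 - a\<close> yields
  \<open>(-a, 0)\<close>.\<close>

lemma congruence_ideal:
  assumes S: "S \<in> cinf_congruences A \<Phi>"
  shows "ideal {a \<in> A. (a, \<zero>\<^bsub>R\<^esub>) \<in> S} R"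
proof (intro idealI R.add.subgroupI R.ring_axioms)
  let ?I = "{a \<in> A. (a, \<zero>\<^bsub>R\<^esub>) \<in> S}"
  note zero = R.zero_closed[unfolded carrier_R]
  show "?I \<noteq> {}"
    using congruence_refl[OF S zero] zero by blast
  show "\<ominus>\<^bsub>R\<^esub> a \<in> ?I" if "a \<in> ?I" for a
  proof -
    have sym: "sym S" using S by (auto simp: cinf_congruences_def equiv_def)
    have "(\<zero>\<^bsub>R\<^esub>, a) \<in> S" using that sym by (auto dest: symD)
    then show ?thesis
      using congruence_iff_diff[OF S zero, of a] that R.a_inv_closed[of a]
      by (simp add: R.minus_eq)
  qed
  show "a \<oplus>\<^bsub>R\<^esub> b \<in> ?I" if "a \<in> ?I" "b \<in> ?I" for a b
    using congruence_add[OF S, of a "\<zero>\<^bsub>R\<^esub>" b "\<zero>\<^bsub>R\<^esub>"] that zero R.a_closed by simp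
  show "b \<otimes>\<^bsub>R\<^esub> a \<in> ?I" if "a \<in> ?I" "b \<in> carrier R" for a b
    using congruence_mult[OF S congruence_refl[OF S, of b], of a "\<zero>\<^bsub>R\<^esub>"] that R.m_closed by simp
  show "a \<otimes>\<^bsub>R\<^esub> b \<in> ?I" if "a \<in> ?I" "b \<in> carrier R" for a b
    using congruence_mult[OF S, of a "\<zero>\<^bsub>R\<^esub>" b b] congruence_refl[OF S, of b] that R.m_closed by simp
qed auto

end

theorem proposition17:
  fixes A :: "'a set" and \<Phi> :: "'a cinf_map"
  assumes "cinf_ring A \<Phi>"
  shows "bij_betw (\<lambda>R. {a \<in> A. (a, \<Phi> 0 (\<lambda>x\<in>Rn 0. 0) (tuple [])) \<in> R})
           (cinf_congruences A \<Phi>) (cinf_ideals A \<Phi>)"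
proof -
  interpret cinfinity_ring A \<Phi> by unfold_locales fact
  have zero: "\<Phi> 0 (\<lambda>x\<in>Rn 0. 0) (tuple []) = \<zero>\<^bsub>R\<^esub>"
    by (simp add: ring_of_cinf_def)
  \<comment> \<open>The inverse map is given explicitly. One composite is the identity because a
    congruence is determined by differences, the other because \<open>a - 0 = a\<close>.\<close>
  show ?thesis
    unfolding zero
  proof (rule bij_betw_byWitness[where f' = "\<lambda>I. {(a, b). a \<in> A \<and> b \<in> A \<and> a \<ominus>\<^bsub>R\<^esub> b \<in> I}"])
    show "\<forall>S\<in>cinf_congruences A \<Phi>.
        {(a, b). a \<in> A \<and> b \<in> A \<and> a \<ominus>\<^bsub>R\<^esub> b \<in> {a \<in> A. (a, \<zero>\<^bsub>R\<^esub>) \<in> S}} = S"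
    proof
      fix S assume S: "S \<in> cinf_congruences A \<Phi>"
      have "a \<in> A \<and> b \<in> A \<and> a \<ominus>\<^bsub>R\<^esub> b \<in> {a \<in> A. (a, \<zero>\<^bsub>R\<^esub>) \<in> S} \<longleftrightarrow> (a, b) \<in> S" for a b
        using congruence_iff_diff[OF S, of a b] congruence_carrier[OF S, of a b]
          R.minus_closed[of a b] by (auto simp del: R.minus_closed)
      then show "{(a, b). a \<in> A \<and> b \<in> A \<and> a \<ominus>\<^bsub>R\<^esub> b \<in> {a \<in> A. (a, \<zero>\<^bsub>R\<^esub>) \<in> S}} = S"
        by blast
    qed
    show "\<forall>I\<in>cinf_ideals A \<Phi>.
        {a \<in> A. (a, \<zero>\<^bsub>R\<^esub>) \<in> {(a, b). a \<in> A \<and> b \<in> A \<and> a \<ominus>\<^bsub>R\<^esub> b \<in> I}} = I"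
    proof
      fix I assume "I \<in> cinf_ideals A \<Phi>"
      then interpret I: ideal I R by (simp add: cinf_ideals_def)
      have "a \<ominus>\<^bsub>R\<^esub> \<zero>\<^bsub>R\<^esub> = a" if "a \<in> A" for a
        using that by (simp add: R.minus_eq)
      then show "{a \<in> A. (a, \<zero>\<^bsub>R\<^esub>) \<in> {(a, b). a \<in> A \<and> b \<in> A \<and> a \<ominus>\<^bsub>R\<^esub> b \<in> I}} = I"
        using I.a_subset R.zero_closed by auto
    qed
  qed (auto simp: cinf_ideals_def ideal_congruence congruence_ideal)
qed

end
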